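(* Let $f\in L^1(0,1)$, let $0<t<1$, and suppose that the one-sided limits $f(t+0)$ and $f(t-0)$ exist. If $f^*=Sf$ is the Markov-Stieltjes transform of $f$, then $$\frac{f(t+0)+f(t-0)}{2}=\frac{1}{2\pi i}\lim_{\eta\to0+}\left(\frac{1}{t-i\eta}f^*\left(\frac{1}{t-i\eta}\right)-\frac{1}{t+i\eta}f^*\left(\frac{1}{t+i\eta}\right)\right).$$
   Context: The Markov-Stieltjes transform of $f\in L^1(0,1)$ is $Sf(z)=\int_0^1\frac{f(s)}{1-sz}\,ds$; it is an analytic function of $z\in\mathbb{C}\setminus[1,\infty)$. *)

theory Defs
  imports "HOL-Analysis.Analysis"
begin

text \<open>The integral is the Lebesgue integral over the open interval, and only the values of
  \<open>f\<close> on it matter. Since it is a total function, it takes the junk value 0 wherever the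
  integrand is not integrable; for \<open>f\<close> integrable on the interval this does not happen
  when \<open>z\<close> lies off the ray from 1 to infinity.\<close>

definition markov_stieltjes :: "(real \<Rightarrow> complex) \<Rightarrow> complex \<Rightarrow> complex" where
  "markov_stieltjes f z = (LINT s:{0<..<1}|lebesgue. f s / (1 - complex_of_real s * z))"

end

theory Submission
  imports Defs
begin

text \<open>At \<open>z = 1 / w\<close> the factor \<open>1 / w\<close> turns the Markov-Stieltjes kernel into the Cauchy kernel
  \<open>1 / (w - s)\<close>. The difference of the Cauchy kernels for \<open>w = t - \<i>\<eta>\<close> and \<open>w = t + \<i>\<eta>\<close> is
  \<open>2\<i>\<close> times the Poisson kernel \<open>\<eta> / ((s - t)\<^sup>2 + \<eta>\<^sup>2)\<close>, which concentrates mass \<open>\<pi> / 2\<close> on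
  each side of \<open>t\<close> as \<open>\<eta>\<close> tends to 0.\<close>

text \<open>Continuity on the compact interval \<open>{a..b}\<close> makes \<open>k\<close> bounded,
  and a bounded measurable factor preserves integrability. It makes the Cauchy and Poisson kernels
  integrable against an \<open>f\<close> that is merely integrable.\<close>

lemma set_integrable_continuous_mult:
  fixes f k :: "real \<Rightarrow> complex"
  assumes f: "set_integrable lebesgue {a<..<b} f" and k: "continuous_on {a..b} k"
  shows "set_integrable lebesgue {a<..<b} (\<lambda>s. k s * f s)"
proof (rule absolutely_integrable_bounded_measurable_product[OF bilinear_times _ _ _ f])
  show "k \<in> borel_measurable (lebesgue_on {a<..<b})"
    by (rule continuous_imp_measurable_on_sets_lebesgue) (auto intro: continuous_on_subset[OF k])
  have "bounded (k ` {a..b})"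
    by (intro compact_imp_bounded compact_continuous_image continuous_on_subset[OF k]) auto
  then show "bounded (k ` {a<..<b})"
    by (rule bounded_subset) auto
qed auto

text \<open>This is \<pi> times the usual Poisson kernel of the upper half-plane at height
  \<open>\<eta>\<close>, so its mass over the whole line is \<pi>.\<close>

definition poisson_kernel :: "real \<Rightarrow> real \<Rightarrow> real" where
  "poisson_kernel \<eta> x = \<eta> / (x\<^sup>2 + \<eta>\<^sup>2)"

lemma continuous_on_poisson_kernel:
  assumes "\<eta> > 0"
  shows "continuous_on S (\<lambda>s. poisson_kernel \<eta> (s - t))"
proof -
  have "(s - t)\<^sup>2 + \<eta>\<^sup>2 \<noteq> 0" for s
    using assms by (simp add: sum_power2_eq_zero_iff)
  then show ?thesis
    unfolding poisson_kernel_def by (intro continuous_intros) auto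
qed

lemma poisson_kernel_nonneg: "\<eta> > 0 \<Longrightarrow> poisson_kernel \<eta> x \<ge> 0"
  by (simp add: poisson_kernel_def)

text \<open>Dropping \<open>\<eta>\<^sup>2\<close> from the denominator leaves at least
  \<open>\<delta>\<^sup>2\<close>. For fixed \<open>\<delta>\<close> this makes the kernel vanish
  uniformly away from its peak as \<open>\<eta>\<close> tends to 0.\<close>

lemma poisson_kernel_le:
  assumes "\<eta> > 0" "\<delta> > 0" "\<delta> \<le> \<bar>x\<bar>"
  shows "poisson_kernel \<eta> x \<le> \<eta> / \<delta>\<^sup>2"
proof -
  have "\<delta>\<^sup>2 \<le> x\<^sup>2 + \<eta>\<^sup>2"
    using assms abs_le_square_iff[of \<delta> x] by (simp add: add_increasing2)
  then show ?thesis
    unfolding poisson_kernel_def using assms by (intro divide_left_mono) (auto simp: add_nonneg_pos)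
qed

lemma set_integrable_poisson_kernel:
  assumes "\<eta> > 0"
  shows "set_integrable lebesgue {a<..<b} (\<lambda>s. poisson_kernel \<eta> (s - t))"
proof (rule set_integrable_subset)
  show "set_integrable lebesgue {a..b} (\<lambda>s. poisson_kernel \<eta> (s - t))"
    by (intro absolutely_integrable_continuous_real continuous_on_poisson_kernel assms)
qed auto

text \<open>An antiderivative is \<open>arctan ((s - t) / \<eta>)\<close>. The fundamental theorem
  of calculus applies on the closed interval, which differs from the open one by a null set.\<close>

lemma set_integral_poisson_kernel:
  assumes "\<eta> > 0" "a \<le> b"
  shows "(LINT s:{a<..<b}|lebesgue. poisson_kernel \<eta> (s - t)) =
    arctan ((b - t) / \<eta>) - arctan ((a - t) / \<eta>)"
proof -
  have "((\<lambda>s. arctan ((s - t) / \<eta>)) has_real_derivative poisson_kernel \<eta> (s - t))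
      (at s within {a..b})" for s
  proof -
    have "\<eta>\<^sup>2 + (s - t)\<^sup>2 > 0"
      using assms by (simp add: add_pos_nonneg)
    then show ?thesis
      using assms unfolding poisson_kernel_def
      by (auto intro!: derivative_eq_intros simp: field_simps power2_eq_square)
  qed
  then have "((\<lambda>s. poisson_kernel \<eta> (s - t)) has_integral
      arctan ((b - t) / \<eta>) - arctan ((a - t) / \<eta>)) {a..b}"
    using assms by (intro fundamental_theorem_of_calculus)
      (auto simp: has_real_derivative_iff_has_vector_derivative[symmetric])
  then show ?thesis
    using assms
    by (simp add: set_lebesgue_integral_eq_integral set_integrable_poisson_kernel
        integral_open_interval_real[symmetric] integral_unique)
qed

text \<open>Near \<open>t\<close> the function \<open>h\<close> is small and the kernel has mass
  below \<pi>; away from \<open>t\<close> the kernel is uniformly small and \<open>h\<close> is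
  integrable.\<close>

lemma poisson_integral_tendsto_0:
  fixes h :: "real \<Rightarrow> complex"
  assumes h: "set_integrable lebesgue {a<..<b} h" and "a \<le> b"
    and lim: "(h \<longlongrightarrow> 0) (at t within {a<..<b})" and t: "t \<notin> {a<..<b}"
  shows "((\<lambda>\<eta>. LINT s:{a<..<b}|lebesgue. complex_of_real (poisson_kernel \<eta> (s - t)) * h s)
    \<longlongrightarrow> 0) (at_right 0)"
proof (rule tendstoI)
  fix e :: real assume "e > 0"
  \<comment> \<open>Multiplied by the kernel mass, which is below \<pi>, this leaves at most half of
    \<open>e\<close> for the part near \<open>t\<close>.\<close>
  define \<epsilon> where "\<epsilon> = e / (2 * pi)"
  have \<epsilon>: "\<epsilon> > 0" using \<open>e > 0\<close> by (simp add: \<epsilon>_def)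
  \<comment> \<open>The limit says nothing about \<open>s = t\<close>, but \<open>t\<close> lies
    outside the open interval, so the bound holds at every point of it near
    \<open>t\<close>.\<close>
  obtain \<delta> where \<delta>: "\<delta> > 0"
    "\<And>s. s \<in> {a<..<b} \<Longrightarrow> dist s t < \<delta> \<Longrightarrow> norm (h s) < \<epsilon>"
    using tendstoD[OF lim \<epsilon>] t unfolding eventually_at by (force simp: dist_norm)
  define C where "C = (LINT s:{a<..<b}|lebesgue. norm (h s)) / \<delta>\<^sup>2"
  have "((\<lambda>\<eta>. \<eta> * C) \<longlongrightarrow> 0 * C) (at_right 0)"
    by (intro tendsto_intros)
  then have "\<forall>\<^sub>F \<eta> in at_right 0. \<eta> * C < e / 2"
    using \<open>e > 0\<close> by (intro order_tendstoD) auto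
  moreover have "\<forall>\<^sub>F \<eta> in at_right 0. \<eta> > (0::real)"
    by (simp add: eventually_at_right_less)
  ultimately show "\<forall>\<^sub>F \<eta> in at_right 0.
      dist (LINT s:{a<..<b}|lebesgue. complex_of_real (poisson_kernel \<eta> (s - t)) * h s) 0 < e"
  proof eventually_elim
    case (elim \<eta>)
    let ?K = "\<lambda>s. poisson_kernel \<eta> (s - t)"
    have int: "set_integrable lebesgue {a<..<b} (\<lambda>s. complex_of_real (?K s) * h s)"
      using elim by (intro set_integrable_continuous_mult h continuous_on_of_real
          continuous_on_poisson_kernel)
    have int1: "set_integrable lebesgue {a<..<b} (\<lambda>s. \<epsilon> * ?K s)"
      using elim by (intro set_integrable_mult_right set_integrable_poisson_kernel)
    have int2: "set_integrable lebesgue {a<..<b} (\<lambda>s. \<eta> / \<delta>\<^sup>2 * norm (h s))"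
      by (intro set_integrable_mult_right set_integrable_norm h)
    have "norm (LINT s:{a<..<b}|lebesgue. complex_of_real (?K s) * h s)
        \<le> (LINT s:{a<..<b}|lebesgue. norm (complex_of_real (?K s) * h s))"
      by (rule set_integral_norm_bound[OF int])
    \<comment> \<open>The sum of the near and far bounds dominates the integrand on the whole
      interval, so the domain need not be split at distance \<open>\<delta>\<close>.\<close>
    also have "\<dots> \<le> (LINT s:{a<..<b}|lebesgue. \<epsilon> * ?K s + \<eta> / \<delta>\<^sup>2 * norm (h s))"
    proof (rule set_integral_mono)
      show "norm (complex_of_real (?K s) * h s) \<le> \<epsilon> * ?K s + \<eta> / \<delta>\<^sup>2 * norm (h s)"
        if "s \<in> {a<..<b}" for s
      proof (cases "dist s t < \<delta>")
        case True
        then have "?K s * norm (h s) \<le> ?K s * \<epsilon>"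
          using \<delta>(2)[OF that] elim by (intro mult_left_mono) (auto simp: poisson_kernel_nonneg)
        moreover have "\<eta> / \<delta>\<^sup>2 * norm (h s) \<ge> 0"
          using elim by simp
        ultimately show ?thesis
          using elim by (simp only: norm_mult norm_of_real abs_of_nonneg poisson_kernel_nonneg
              mult.commute[of \<epsilon>] add_increasing2)
      next
        case False
        then have "?K s * norm (h s) \<le> \<eta> / \<delta>\<^sup>2 * norm (h s)"
          using elim \<delta>(1) by (intro mult_right_mono poisson_kernel_le) (auto simp: dist_norm)
        moreover have "\<epsilon> * ?K s \<ge> 0"
          using elim \<epsilon> by (simp add: poisson_kernel_nonneg)
        ultimately show ?thesis
          using elim by (simp add: norm_mult poisson_kernel_nonneg)
      qed
    qed (use set_integrable_norm[OF int] set_integral_add(1)[OF int1 int2] in auto)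
    also have "\<dots> = \<epsilon> * (arctan ((b - t) / \<eta>) - arctan ((a - t) / \<eta>)) + \<eta> * C"
      using elim \<open>a \<le> b\<close> set_integral_add(2)[OF int1 int2]
      by (simp add: set_integral_poisson_kernel C_def)
    also have "\<dots> < \<epsilon> * pi + e / 2"
      using elim \<epsilon> arctan_ubound[of "(b - t) / \<eta>"] arctan_lbound[of "(a - t) / \<eta>"]
      by (intro add_strict_mono mult_strict_left_mono) auto
    also have "\<dots> = e"
      by (simp add: \<epsilon>_def)
    finally show ?case by simp
  qed
qed

text \<open>Write \<open>f\<close> as \<open>(f - l) + l\<close>. The first part contributes 0 in
  the limit, and the constant contributes \<open>l\<close> times the kernel mass, which tends to
  half of \<pi> because \<open>t\<close> is an endpoint.\<close>

lemma poisson_integral_tendsto: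
  fixes f :: "real \<Rightarrow> complex"
  assumes f: "set_integrable lebesgue {a<..<b} f" and "a < b"
    and lim: "(f \<longlongrightarrow> l) (at t within {a<..<b})" and t: "t = a \<or> t = b"
  shows "((\<lambda>\<eta>. LINT s:{a<..<b}|lebesgue. complex_of_real (poisson_kernel \<eta> (s - t)) * f s)
    \<longlongrightarrow> complex_of_real (pi / 2) * l) (at_right 0)"
proof -
  let ?A = "\<lambda>\<eta>. arctan ((b - t) / \<eta>) - arctan ((a - t) / \<eta>)"
  let ?I = "\<lambda>g \<eta>. LINT s:{a<..<b}|lebesgue. complex_of_real (poisson_kernel \<eta> (s - t)) * g s"
  have const: "set_integrable lebesgue {a<..<b} (\<lambda>s. l)"
    by (rule set_integrable_subset[OF absolutely_integrable_continuous_real, of a b]) auto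
  have h: "set_integrable lebesgue {a<..<b} (\<lambda>s. f s - l)"
    by (intro set_integral_diff f const)
  have inv: "filterlim (\<lambda>\<eta>. c / \<eta>) at_top (at_right 0)" if "c > 0" for c :: real
    using that filterlim_tendsto_pos_mult_at_top[OF tendsto_const that filterlim_inverse_at_top_right]
    by (simp add: divide_inverse)
  have arctan_lim: "((\<lambda>\<eta>. arctan (c / \<eta>)) \<longlongrightarrow> pi / 2) (at_right 0)" if "c > 0" for c :: real
    by (rule filterlim_compose[OF tendsto_arctan_at_top inv[OF that]])
  \<comment> \<open>At the endpoint equal to \<open>t\<close> the arctangent is 0. Since arctan is
    odd, the other term is \<open>arctan ((b - a) / \<eta>)\<close> in both cases.\<close>
  have A: "(?A \<longlongrightarrow> pi / 2) (at_right 0)"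
    using arctan_lim[of "b - a"] t \<open>a < b\<close>
    by (auto simp: arctan_minus[symmetric] minus_divide_left simp del: arctan_minus)
  have "((\<lambda>\<eta>. ?I (\<lambda>s. f s - l) \<eta> + complex_of_real (?A \<eta>) * l) \<longlongrightarrow>
      0 + complex_of_real (pi / 2) * l) (at_right 0)"
    using t \<open>a < b\<close> lim
    by (intro tendsto_add tendsto_mult tendsto_of_real A tendsto_const
        poisson_integral_tendsto_0[OF h]) (auto intro: LIM_zero)
  moreover have "\<forall>\<^sub>F \<eta> in at_right 0.
      ?I (\<lambda>s. f s - l) \<eta> + complex_of_real (?A \<eta>) * l = ?I f \<eta>"
    using eventually_at_right_less[of 0]
  proof eventually_elim
    case (elim \<eta>)
    have mult: "set_integrable lebesgue {a<..<b} g \<Longrightarrow> set_integrable lebesgue {a<..<b}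
        (\<lambda>s. complex_of_real (poisson_kernel \<eta> (s - t)) * g s)" for g
      using elim by (intro set_integrable_continuous_mult continuous_on_of_real
          continuous_on_poisson_kernel)
    have "complex_of_real (?A \<eta>) * l = ?I (\<lambda>s. l) \<eta>"
      using elim \<open>a < b\<close>
      by (simp add: set_integral_complex_of_real set_integral_poisson_kernel[symmetric]
          del: of_real_diff)
    then show ?case
      using set_integral_add(2)[OF mult[OF h] mult[OF const]] by (simp add: algebra_simps)
  qed
  ultimately show ?thesis
    by (auto elim: Lim_transform_eventually)
qed

lemma markov_stieltjes_inverse:
  assumes "w \<noteq> 0"
  shows "1 / w * markov_stieltjes f (1 / w) =
    (LINT s:{0<..<1}|lebesgue. 1 / (w - complex_of_real s) * f s)"
proof -
  \<comment> \<open>If \<open>w\<close> is the real number \<open>s\<close>, both denominators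
    vanish and both sides are 0 by the convention for division by zero.\<close>
  have "1 / w * (f s / (1 - complex_of_real s * (1 / w))) = 1 / (w - complex_of_real s) * f s" for s
    using assms by (cases "w = complex_of_real s") (auto simp: field_simps)
  then show ?thesis
    unfolding markov_stieltjes_def set_integral_mult_right[symmetric] by (simp only:)
qed

lemma cauchy_kernel_diff:
  assumes "\<eta> > 0"
  shows "1 / (complex_of_real t - \<i> * complex_of_real \<eta> - complex_of_real s)
      - 1 / (complex_of_real t + \<i> * complex_of_real \<eta> - complex_of_real s)
    = 2 * \<i> * complex_of_real (poisson_kernel \<eta> (s - t))"
proof -
  define x where "x = complex_of_real (t - s)"
  define y where "y = complex_of_real \<eta>"
  have ne: "x - \<i> * y \<noteq> 0" "x + \<i> * y \<noteq> 0"
    using assms by (auto simp: x_def y_def complex_eq_iff)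
  have prod: "(x - \<i> * y) * (x + \<i> * y) = x\<^sup>2 + y\<^sup>2"
    by (simp add: power2_eq_square algebra_simps)
  have "1 / (x - \<i> * y) - 1 / (x + \<i> * y) = 2 * \<i> * y / ((x - \<i> * y) * (x + \<i> * y))"
    using ne by (simp add: divide_simps)
  also have "\<dots> = 2 * \<i> * complex_of_real (poisson_kernel \<eta> (s - t))"
    \<comment> \<open>The kernel is even, so \<open>t - s\<close> may be replaced by
      \<open>s - t\<close>.\<close>
    unfolding prod by (simp add: x_def y_def poisson_kernel_def power2_commute)
  finally show ?thesis
    by (simp add: x_def y_def algebra_simps)
qed

text \<open>The single point \<open>t\<close> is null. Passing to gauge integrals over closed
  intervals reduces the claim to their additivity.\<close>

lemma set_integral_split_Ioo:
  fixes g :: "real \<Rightarrow> complex"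
  assumes g: "set_integrable lebesgue {a<..<b} g" and "a < t" "t < b"
  shows "(LINT s:{a<..<b}|lebesgue. g s) =
    (LINT s:{a<..<t}|lebesgue. g s) + (LINT s:{t<..<b}|lebesgue. g s)"
proof -
  have "set_integrable lebesgue {a<..<t} g" "set_integrable lebesgue {t<..<b} g"
    using assms by (auto intro: set_integrable_subset[OF g])
  moreover have "g integrable_on {a..b}"
    using set_lebesgue_integral_eq_integral(1)[OF g] by (simp add: integrable_on_Icc_iff_Ioo)
  ultimately show ?thesis
    using g assms Henstock_Kurzweil_Integration.integral_combine[of a t b g]
    by (simp add: set_lebesgue_integral_eq_integral integral_open_interval_real[symmetric])
qed

theorem theorem2p1:
  fixes f :: "real \<Rightarrow> complex" and t :: real and f_plus f_minus :: complex
  assumes "set_integrable lebesgue {0<..<1} f"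
    and "0 < t" and "t < 1"
    and "(f \<longlongrightarrow> f_plus) (at_right t)"
    and "(f \<longlongrightarrow> f_minus) (at_left t)"
  shows "\<exists>L. ((\<lambda>\<eta>::real.
              1 / (complex_of_real t - \<i> * complex_of_real \<eta>)
                * markov_stieltjes f (1 / (complex_of_real t - \<i> * complex_of_real \<eta>))
            - 1 / (complex_of_real t + \<i> * complex_of_real \<eta>)
                * markov_stieltjes f (1 / (complex_of_real t + \<i> * complex_of_real \<eta>)))
            \<longlongrightarrow> L) (at_right 0)
          \<and> (f_plus + f_minus) / 2 = 1 / (2 * complex_of_real pi * \<i>) * L"
proof -
  let ?P = "\<lambda>\<eta> s. complex_of_real (poisson_kernel \<eta> (s - t)) * f s"
  let ?D = "\<lambda>\<eta>. 1 / (complex_of_real t - \<i> * complex_of_real \<eta>)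
        * markov_stieltjes f (1 / (complex_of_real t - \<i> * complex_of_real \<eta>))
      - 1 / (complex_of_real t + \<i> * complex_of_real \<eta>)
        * markov_stieltjes f (1 / (complex_of_real t + \<i> * complex_of_real \<eta>))"
  \<comment> \<open>Each side of \<open>t\<close> contributes \<pi>/2 times its one-sided limit; the
    factor \<open>2 * \<i>\<close> comes from the difference of Cauchy kernels. Dividing by
    \<open>2 * pi * \<i>\<close> leaves the mean.\<close>
  define L where "L = 2 * \<i> * (complex_of_real (pi / 2) * f_minus + complex_of_real (pi / 2) * f_plus)"
  have f: "set_integrable lebesgue {0<..<t} f" "set_integrable lebesgue {t<..<1} f"
    using assms(2,3) by (auto intro: set_integrable_subset[OF assms(1)])
  have "((\<lambda>\<eta>. LINT s:{0<..<t}|lebesgue. ?P \<eta> s) \<longlongrightarrow> complex_of_real (pi / 2) * f_minus) (at_right 0)"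
    using assms(2) f by (intro poisson_integral_tendsto tendsto_within_subset[OF assms(5)]) auto
  moreover have "((\<lambda>\<eta>. LINT s:{t<..<1}|lebesgue. ?P \<eta> s) \<longlongrightarrow> complex_of_real (pi / 2) * f_plus) (at_right 0)"
    using assms(3) f by (intro poisson_integral_tendsto tendsto_within_subset[OF assms(4)]) auto
  ultimately have "((\<lambda>\<eta>. 2 * \<i> * ((LINT s:{0<..<t}|lebesgue. ?P \<eta> s) + (LINT s:{t<..<1}|lebesgue. ?P \<eta> s)))
      \<longlongrightarrow> L) (at_right 0)"
    unfolding L_def by (intro tendsto_intros)
  moreover have "\<forall>\<^sub>F \<eta> in at_right 0.
      2 * \<i> * ((LINT s:{0<..<t}|lebesgue. ?P \<eta> s) + (LINT s:{t<..<1}|lebesgue. ?P \<eta> s)) = ?D \<eta>"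
    using eventually_at_right_less[of 0]
  proof eventually_elim
    case (elim \<eta>)
    define w where "w = complex_of_real t - \<i> * complex_of_real \<eta>"
    define w' where "w' = complex_of_real t + \<i> * complex_of_real \<eta>"
    \<comment> \<open>Off the real axis the Cauchy kernel has no pole on \<open>{0..1}\<close>.
      Integrability of both terms is what allows the difference of the two integrals to be merged
      into one.\<close>
    have cauchy: "set_integrable lebesgue {0<..<1} (\<lambda>s. 1 / (z - complex_of_real s) * f s)"
      if "Im z \<noteq> 0" for z
    proof (rule set_integrable_continuous_mult[OF assms(1)])
      have "z \<noteq> complex_of_real s" for s
        using that by auto
      then show "continuous_on {0..1} (\<lambda>s. 1 / (z - complex_of_real s))"
        by (intro continuous_intros) auto
    qed
    have Im: "Im w \<noteq> 0" "Im w' \<noteq> 0"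
      using elim by (auto simp: w_def w'_def)
    then have ne: "w \<noteq> 0" "w' \<noteq> 0"
      by auto
    have "?D \<eta> = (LINT s:{0<..<1}|lebesgue. 1 / (w - complex_of_real s) * f s)
        - (LINT s:{0<..<1}|lebesgue. 1 / (w' - complex_of_real s) * f s)"
      unfolding w_def[symmetric] w'_def[symmetric] ne[THEN markov_stieltjes_inverse] ..
    also have "\<dots> = (LINT s:{0<..<1}|lebesgue.
        (1 / (w - complex_of_real s) - 1 / (w' - complex_of_real s)) * f s)"
      unfolding left_diff_distrib using Im by (simp only: set_integral_diff(2) cauchy not_False_eq_True)
    also have "\<dots> = (LINT s:{0<..<1}|lebesgue. 2 * \<i> * ?P \<eta> s)"
      unfolding w_def w'_def cauchy_kernel_diff[OF elim] by (simp only: mult.assoc)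
    also have "\<dots> = 2 * \<i> * (LINT s:{0<..<1}|lebesgue. ?P \<eta> s)"
      by (rule set_integral_mult_right)
    also have "(LINT s:{0<..<1}|lebesgue. ?P \<eta> s) =
        (LINT s:{0<..<t}|lebesgue. ?P \<eta> s) + (LINT s:{t<..<1}|lebesgue. ?P \<eta> s)"
      using assms elim
      by (intro set_integral_split_Ioo set_integrable_continuous_mult continuous_on_of_real
          continuous_on_poisson_kernel)
    finally show ?case ..
  qed
  ultimately have "(?D \<longlongrightarrow> L) (at_right 0)"
    by (rule Lim_transform_eventually)
  moreover have "(f_plus + f_minus) / 2 = 1 / (2 * complex_of_real pi * \<i>) * L"
    by (simp add: L_def field_simps)
  ultimately show ?thesis
    by blast
qed

end
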